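(* Let $G=(V,E)$ be any finite undirected graph with at least one edge, and let $n=|V|$. Run the Ranking algorithm on $G$ (defined in the context). Then $$\frac{\mathbb{E}[\text{number of nodes matched by Ranking}]}{\text{number of nodes covered by a maximum matching of } G}\;\ge\;\frac{2(5-\sqrt{7})}{9}\approx 0.523,$$ where the expectation is over the uniformly random permutation chosen by Ranking.
   Context: A permutation of $V$ is a bijection $\sigma:V\to[n]$ where $[n]=\{1,\dots,n\}$; $\sigma(u)$ is the rank of $u$ (smaller rank = higher priority). The Ranking algorithm chooses $\sigma$ uniformly at random among all $n!$ permutations and forms a list $L$ of all unordered pairs of distinct nodes, ordered lexicographically according to $\sigma$: write each pair as $\{u,v\}$ with $\sigma(u)<\sigma(v)$; pair $\{u_1,v_1\}$ precedes $\{u_2,v_2\}$ iff $\sigma(u_1)<\sigma(u_2)$, or $u_1=u_2$ and $\sigma(v_1)<\sigma(v_2)$. Initially all nodes are unmatched. The pairs are probed in the order of $L$; when $\{u,v\}$ is probed, if both $u,v$ are currently unmatched and $\{u,v\}\in E$, then $u$ and $v$ become matched to each other; otherwise nothing happens. The result is a (maximal) matching of $G$. The edges of $G$ are not used in choosing $L$. *)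

theory Defs
  imports "HOL-Probability.Probability"
begin

definition finite_graph :: "'a set \<Rightarrow> 'a set set \<Rightarrow> bool" where
  "finite_graph V E \<longleftrightarrow> finite V \<and> (\<forall>e\<in>E. e \<subseteq> V \<and> card e = 2)"

definition matching :: "'a set set \<Rightarrow> 'a set set \<Rightarrow> bool" where
  "matching E M \<longleftrightarrow> M \<subseteq> E \<and> disjoint M"

definition maximum_matching :: "'a set set \<Rightarrow> 'a set set \<Rightarrow> bool" where
  "maximum_matching E M \<longleftrightarrow> matching E M \<and> (\<forall>M'. matching E M' \<longrightarrow> card M' \<le> card M)"

definition covered :: "'a set set \<Rightarrow> 'a set" where
  "covered M = \<Union>M"

text \<open>Bijections from the nodes to \<open>{1..n}\<close>. Extensionality makes each of them occur
  as exactly one HOL function, so that the uniform distribution below is the intended one.\<close>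

definition rankings :: "'a set \<Rightarrow> ('a \<Rightarrow> nat) set" where
  "rankings V = {\<sigma> \<in> extensional V. bij_betw \<sigma> V {1..card V}}"

text \<open>An unordered pair of distinct nodes is represented by the ordered pair that lists
  the node of smaller rank first.\<close>

definition node_pairs :: "'a set \<Rightarrow> ('a \<Rightarrow> nat) \<Rightarrow> ('a \<times> 'a) set" where
  "node_pairs V \<sigma> = {(u, v). u \<in> V \<and> v \<in> V \<and> \<sigma> u < \<sigma> v}"

definition precedes :: "('a \<Rightarrow> nat) \<Rightarrow> 'a \<times> 'a \<Rightarrow> 'a \<times> 'a \<Rightarrow> bool" where
  "precedes \<sigma> = (\<lambda>(u1, v1) (u2, v2). \<sigma> u1 < \<sigma> u2 \<or> (u1 = u2 \<and> \<sigma> v1 < \<sigma> v2))"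

text \<open>Such a list is unique by \<open>probe_list_ex1\<close>; it has no repetitions because
  \<open>precedes\<close> is irreflexive.\<close>

definition probe_list :: "'a set \<Rightarrow> ('a \<Rightarrow> nat) \<Rightarrow> ('a \<times> 'a) list" where
  "probe_list V \<sigma> = (THE L. set L = node_pairs V \<sigma> \<and> sorted_wrt (precedes \<sigma>) L)"

definition probe :: "'a set set \<Rightarrow> 'a set set \<Rightarrow> 'a \<times> 'a \<Rightarrow> 'a set set" where
  "probe E M = (\<lambda>(u, v).
     if u \<notin> covered M \<and> v \<notin> covered M \<and> {u, v} \<in> E then insert {u, v} M else M)"

definition ranking_matching :: "'a set \<Rightarrow> 'a set set \<Rightarrow> ('a \<Rightarrow> nat) \<Rightarrow> 'a set set" where
  "ranking_matching V E \<sigma> = foldl (probe E) {} (probe_list V \<sigma>)"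

definition expected_matched :: "'a set \<Rightarrow> 'a set set \<Rightarrow> real" where
  "expected_matched V E = measure_pmf.expectation (pmf_of_set (rankings V))
     (\<lambda>\<sigma>. real (card (covered (ranking_matching V E \<sigma>))))"

lemma finite_rankings:
  assumes "finite V"
  shows "finite (rankings V)"
proof (rule finite_subset)
  show "rankings V \<subseteq> V \<rightarrow>\<^sub>E {1..card V}"
    by (auto simp: rankings_def PiE_def bij_betw_def)
  show "finite (V \<rightarrow>\<^sub>E {1..card V})"
    using assms by (intro finite_PiE) auto
qed

lemma rankings_nonempty:
  assumes "finite V"
  shows "rankings V \<noteq> {}"
proof -
  obtain h where "bij_betw h V {1..card V}"
    using assms ex_bij_betw_finite_nat
    by (metis card_atLeastAtMost diff_Suc_1 finite_atLeastAtMost finite_same_card_bij)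
  then have "restrict h V \<in> rankings V"
    by (simp add: rankings_def)
  then show ?thesis by blast
qed

lemma probe_list_ex1:
  assumes fin: "finite V" and s: "\<sigma> \<in> rankings V"
  shows "\<exists>!L. set L = node_pairs V \<sigma> \<and> sorted_wrt (precedes \<sigma>) L"
proof -
  define A where "A = node_pairs V \<sigma>"
  define k where "k = (\<lambda>(u, v). \<sigma> u * (card V + 1) + \<sigma> v)"
  have inj: "inj_on \<sigma> V" and le: "\<And>u. u \<in> V \<Longrightarrow> \<sigma> u \<le> card V"
    using s by (auto simp: rankings_def bij_betw_def)
  have finA: "finite A"
    by (rule finite_subset[of _ "V \<times> V"]) (use fin in \<open>auto simp: A_def node_pairs_def\<close>)
  have step: "a * (n + 1) + b < c * (n + 1) + d"
    if "a < c" "b \<le> n" for a b c d n :: nat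
  proof -
    have "(a + 1) * (n + 1) \<le> c * (n + 1)" using that by (intro mult_le_mono1) simp
    then show ?thesis using that by (simp add: algebra_simps)
  qed
  have key: "k p < k q \<longleftrightarrow> precedes \<sigma> p q" if p: "p \<in> A" and q: "q \<in> A" for p q
  proof -
    obtain u v x y where [simp]: "p = (u, v)" "q = (x, y)" by fastforce
    have V: "u \<in> V" "v \<in> V" "x \<in> V" "y \<in> V"
      using p q by (auto simp: A_def node_pairs_def)
    consider "\<sigma> u < \<sigma> x" | "\<sigma> x < \<sigma> u" | "u = x"
      using inj V by (meson inj_onD linorder_neqE_nat)
    then show ?thesis
    proof cases
      case 1
      then show ?thesis using step[OF 1 le[OF V(2)], of "\<sigma> y"] by (simp add: k_def precedes_def)
    next
      case 2
      then show ?thesis using step[OF 2 le[OF V(4)], of "\<sigma> v"] by (auto simp: k_def precedes_def)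
    next
      case 3
      then show ?thesis by (simp add: k_def precedes_def)
    qed
  qed
  have injk: "inj_on k A"
  proof (rule inj_onI)
    fix p q assume pq: "p \<in> A" "q \<in> A" "k p = k q"
    then have "\<not> precedes \<sigma> p q" "\<not> precedes \<sigma> q p"
      using key[of p q] key[of q p] by auto
    then show "p = q"
      using pq inj unfolding precedes_def A_def node_pairs_def
      by (auto dest: inj_onD split: prod.splits)
  qed
  have sorted_key: "sorted_wrt (precedes \<sigma>) L \<longleftrightarrow> sorted_wrt (<) (map k L)" if "set L = A" for L
    using key that by (auto simp: sorted_wrt_map intro: sorted_wrt_mono_rel[rotated])
  define L0 where "L0 = map (inv_into A k) (sorted_list_of_set (k ` A))"
  have setL0: "set L0 = A"
    using finA injk by (simp add: L0_def image_image)
  have "map k L0 = sorted_list_of_set (k ` A)"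
    using finA unfolding L0_def map_map by (intro map_idI) (simp add: f_inv_into_f)
  then have "sorted_wrt (precedes \<sigma>) L0"
    using sorted_key[OF setL0] by simp
  moreover have "L = L'" if "set L = A" "set L' = A"
    "sorted_wrt (precedes \<sigma>) L" "sorted_wrt (precedes \<sigma>) L'" for L L'
  proof -
    have "map k L = map k L'"
      using that sorted_key strict_sorted_equal[of "map k L" "map k L'"] by simp
    then show ?thesis using that injk by (metis Un_absorb map_inj_on)
  qed
  ultimately show ?thesis unfolding A_def[symmetric] using setL0 by blast
qed

lemma matching_ranking_matching: "matching E (ranking_matching V E \<sigma>)"
proof -
  have "matching E (foldl (probe E) M L)" if "matching E M" for M L
    using that
  proof (induction L arbitrary: M)
    case (Cons p L)
    have "matching E (probe E M p)"
      using Cons.prems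
      by (auto simp: matching_def probe_def covered_def pairwise_insert disjnt_def split: prod.splits)
    then show ?case using Cons.IH by simp
  qed simp
  then show ?thesis by (simp add: ranking_matching_def matching_def)
qed

lemma maximum_matching_exists:
  assumes "finite_graph V E"
  shows "\<exists>M. maximum_matching E M"
proof -
  have "finite E"
    by (rule finite_subset[of _ "Pow V"]) (use assms in \<open>auto simp: finite_graph_def\<close>)
  then have "\<forall>M. matching E M \<longrightarrow> card M < card E + 1"
    by (simp add: matching_def card_mono less_Suc_eq_le)
  moreover have "matching E {}" by (simp add: matching_def)
  ultimately show ?thesis
    using ex_has_greatest_nat[of "matching E" "{}" card "card E + 1"]
    by (auto simp: maximum_matching_def intro: less_imp_le)
qed

end

theory Submission
  imports Defs
begin

text \<open>
  Deleting a node outside the maximum matching \<open>M\<close> never increases the number of matched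
  nodes, so one may assume that \<open>M\<close> is perfect; let \<open>m\<close> be the mate map of \<open>M\<close>. Let \<open>y s\<close>
  be the probability that the node at position \<open>s\<close> (of \<open>n\<close>, counted from 0) stays unmatched.

  \<^item> An unmatched node stays unmatched, with the same resulting matching, when it is moved
    further back, so \<open>y\<close> is nondecreasing.
  \<^item> If \<open>u\<close> is unmatched, then \<open>m u\<close> is matched to a node that precedes \<open>u\<close>. Charging \<open>u\<close> to
    that node gives \<open>(n - s) y s + 2 (y 0 + \<dots> + y (s - 1)) \<le> s\<close>.
  \<^item> In a fixed permutation, with set \<open>C\<close> of matched nodes, let \<open>R\<close> be the set of nodes that
    would be unmatched if moved to the end, and \<open>D\<close> the set of \<open>a \<in> R \<inter> C\<close> with \<open>m a \<notin> C\<close>.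
    Deleting \<open>a \<in> D\<close> changes the matching along an alternating path that ends in \<open>m a\<close>. Mapping
    \<open>a\<close> to the last node on this path that loses its partner (to the partner of \<open>a\<close> if that node
    is \<open>a\<close> itself) is an injection from \<open>D\<close> to \<open>C - D\<close>, whence \<open>2 |R| \<le> 3 |C|\<close>. On average
    this says \<open>2 n y (n - 1) \<le> 3 (n - (y 0 + \<dots> + y (n - 1)))\<close>.

  With \<open>c = y (n - 1)\<close> and \<open>q\<close> the mean of the \<open>y s\<close>, the first two constraints give
  \<open>q \<le> c - c\<^sup>2 / 2\<close> and the third one gives \<open>2 c \<le> 3 (1 - q)\<close>. Both are tight at
  \<open>c = (5 - sqrt 7) / 3\<close>, where \<open>1 - q = 2 (5 - sqrt 7) / 9\<close>.
\<close>

section \<open>Greedy matching along a list of pairs\<close>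

text \<open>The available nodes \<open>A\<close> are an argument, so deleting a node is the same run
  on \<open>A - {u}\<close>, and two runs can be compared by induction on one list.\<close>

fun greedy :: "'a set set \<Rightarrow> 'a set \<Rightarrow> ('a \<times> 'a) list \<Rightarrow> 'a set set" where
  "greedy E A [] = {}"
| "greedy E A ((u, v) # L) =
    (if u \<in> A \<and> v \<in> A \<and> {u, v} \<in> E then insert {u, v} (greedy E (A - {u, v}) L)
     else greedy E A L)"

text \<open>For the nodes in order of rank this is the probe list
  (\<open>probe_list_eq_lex_pairs\<close>); the recursion isolates the consecutive probes of the
  first node.\<close>

fun lex_pairs :: "'a list \<Rightarrow> ('a \<times> 'a) list" where
  "lex_pairs [] = []"
| "lex_pairs (x # xs) = map (Pair x) xs @ lex_pairs xs"

definition insert_nth :: "nat \<Rightarrow> 'a \<Rightarrow> 'a list \<Rightarrow> 'a list" where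
  "insert_nth i x xs = take i xs @ x # drop i xs"

lemma greedy_subset_E: "greedy E A L \<subseteq> E"
  by (induction E A L rule: greedy.induct) auto

lemma covered_greedy: "covered (greedy E A L) \<subseteq> A"
  by (induction E A L rule: greedy.induct) (auto simp: covered_def split: if_splits)

lemma greedy_edgeD: "{x, y} \<in> greedy E A L \<Longrightarrow> x \<in> A \<and> y \<in> A \<and> {x, y} \<in> E"
  using covered_greedy[of E A L] greedy_subset_E[of E A L] by (auto simp: covered_def)

lemma covered_insert [simp]: "covered (insert e M) = e \<union> covered M"
  by (simp add: covered_def)

lemma covered_empty [simp]: "covered {} = {}"
  by (simp add: covered_def)

lemma coveredI: "{x, y} \<in> M \<Longrightarrow> x \<in> covered M" "{x, y} \<in> M \<Longrightarrow> y \<in> covered M"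
  by (auto simp: covered_def)

lemma foldl_probe_eq_greedy:
  assumes "set L \<subseteq> V \<times> V"
  shows "foldl (probe E) M L = M \<union> greedy E (V - covered M) L"
  using assms
proof (induction L arbitrary: M)
  case (Cons p L)
  obtain u v where p: "p = (u, v)" by fastforce
  have "V - covered (insert {u, v} M) = V - covered M - {u, v}" by auto
  then show ?case using Cons by (auto simp: p probe_def)
qed simp

lemma set_lex_pairs_subset: "set (lex_pairs xs) \<subseteq> set xs \<times> set xs"
  by (induction xs) auto

lemma lex_pairs_total:
  "x \<in> set xs \<Longrightarrow> y \<in> set xs \<Longrightarrow> x \<noteq> y \<Longrightarrow> (x, y) \<in> set (lex_pairs xs) \<or> (y, x) \<in> set (lex_pairs xs)"
  by (induction xs) auto

lemma greedy_filter:
  "greedy E (A - {u}) (filter (\<lambda>(x, y). x \<noteq> u \<and> y \<noteq> u) L) = greedy E (A - {u}) L"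
proof (induction L arbitrary: A)
  case (Cons p L)
  have "A - {u} - {x, y} = A - {x, y} - {u}" for x y by auto
  then show ?case using Cons by (cases p) auto
qed simp

lemma filter_lex_pairs:
  "filter (\<lambda>(x, y). x \<noteq> u \<and> y \<noteq> u) (lex_pairs xs) = lex_pairs (removeAll u xs)"
proof (induction xs)
  case (Cons x xs)
  have "filter (\<lambda>(x, y). x \<noteq> u \<and> y \<noteq> u) (map (Pair x) xs) = (if x = u then [] else map (Pair x) (removeAll u xs))"
    by (induction xs) auto
  with Cons show ?case by auto
qed simp

lemma greedy_lex_pairs_removeAll:
  "greedy E (A - {u}) (lex_pairs (removeAll u xs)) = greedy E (A - {u}) (lex_pairs xs)"
  using greedy_filter[of E A u "lex_pairs xs"] by (simp add: filter_lex_pairs)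

section \<open>Greedy matchings in a simple graph, alternating paths and the boundary
  inequality\<close>

locale simple_edges =
  fixes E :: "'a set set"
  assumes card_edge: "e \<in> E \<Longrightarrow> card e = 2"
begin

lemma edge_neq: "{x, y} \<in> E \<Longrightarrow> x \<noteq> y"
  using card_edge by fastforce

lemma disjoint_greedy: "disjoint (greedy E A L)"
proof (induction L arbitrary: A)
  case (Cons p L)
  obtain u v where p: "p = (u, v)" by fastforce
  have "\<forall>e\<in>greedy E (A - {u, v}) L. {u, v} \<inter> e = {}"
    using covered_greedy[of E "A - {u, v}" L] by (auto simp: covered_def)
  then show ?case using Cons[of A] Cons[of "A - {u, v}"]
    by (auto simp: p pairwise_insert disjnt_def)
qed simp

lemma disjoint_partner_unique:
  assumes "disjoint M" "{x, y} \<in> M" "{x, z} \<in> M"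
  shows "y = z"
proof -
  have "{x, y} = {x, z}"
  proof (rule ccontr)
    assume "{x, y} \<noteq> {x, z}"
    with assms have "disjnt {x, y} {x, z}" by (rule pairwiseD)
    then show False by (simp add: disjnt_def)
  qed
  then show ?thesis by (metis doubleton_eq_iff)
qed

lemmas greedy_partner_unique = disjoint_partner_unique[OF disjoint_greedy]

lemma coveredE:
  assumes "M \<subseteq> E" "x \<in> covered M"
  obtains y where "{x, y} \<in> M"
proof -
  obtain e where e: "e \<in> M" "x \<in> e" using assms(2) by (auto simp: covered_def)
  then have "card e = 2" using card_edge assms(1) by auto
  then obtain a b where ab: "e = {a, b}" by (auto simp: card_2_iff)
  then consider "x = a" | "x = b" using e(2) by blast
  then show ?thesis using that e(1) ab by cases (auto simp: insert_commute)
qed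

lemmas covered_greedyE = coveredE[OF greedy_subset_E]

lemma greedy_maximal:
  assumes "(x, y) \<in> set L \<or> (y, x) \<in> set L" "x \<in> A" "y \<in> A" "{x, y} \<in> E"
  shows "x \<in> covered (greedy E A L) \<or> y \<in> covered (greedy E A L)"
  using assms
proof (induction L arbitrary: A)
  case (Cons p L)
  obtain u v where p: "p = (u, v)" by fastforce
  show ?case
    using Cons.prems Cons.IH[of A] Cons.IH[of "A - {u, v}"]
    by (auto simp: p insert_commute)
qed simp

text \<open>At any time the sets of available nodes of the two runs differ by exactly one node,
  which is the current end of the alternating path.\<close>

lemma available_greedy_remove:
  assumes "z \<in> A"
  shows "\<exists>y. let C = A - covered (greedy E A L); C' = A - {z} - covered (greedy E (A - {z}) L) in
    (y \<notin> C' \<and> C = insert y C') \<or> (y \<notin> C \<and> C' = insert y C)"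
  using assms
proof (induction L arbitrary: A z)
  case Nil
  then show ?case by (auto simp: Let_def)
next
  case (Cons p L)
  obtain u v where p: "p = (u, v)" by fastforce
  show ?case
  proof (cases "u \<in> A \<and> v \<in> A \<and> {u, v} \<in> E")
    case True
    then have uv: "u \<noteq> v" using edge_neq by blast
    consider "z \<noteq> u" "z \<noteq> v" | "z = u" | "z = v" by blast
    then show ?thesis
    proof cases
      case 1
      have "A - {z} - {u, v} = A - {u, v} - {z}" by auto
      moreover have "A - covered (greedy E A (p # L)) = A - {u, v} - covered (greedy E (A - {u, v}) L)"
        using True by (auto simp: p)
      moreover have "A - {z} - covered (greedy E (A - {z}) (p # L)) =
          A - {u, v} - {z} - covered (greedy E (A - {u, v} - {z}) L)"
        using True 1 calculation(1) by (auto simp: p)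
      ultimately show ?thesis using Cons.IH[of z "A - {u, v}"] Cons.prems 1 by simp
    next
      \<comment> \<open>The full run matches \<open>z = u\<close> to \<open>v\<close>. The tails
        then start from \<open>A - {u} - {v}\<close> and \<open>A - {u}\<close>: the runs swap
        roles, with \<open>v\<close> as the deleted node.\<close>
      case 2
      have "A - covered (greedy E A (p # L)) = A - {u} - {v} - covered (greedy E (A - {u} - {v}) L)"
        using True by (auto simp: p Diff_insert2[symmetric] insert_commute)
      moreover have "greedy E (A - {z}) (p # L) = greedy E (A - {u}) L"
        using 2 by (simp add: p)
      ultimately show ?thesis using Cons.IH[of v "A - {u}"] True uv 2 by (auto simp: Let_def)
    next
      case 3
      have "A - covered (greedy E A (p # L)) = A - {v} - {u} - covered (greedy E (A - {v} - {u}) L)"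
        using True by (auto simp: p Diff_insert2[symmetric] insert_commute)
      moreover have "greedy E (A - {z}) (p # L) = greedy E (A - {v}) L"
        using 3 by (simp add: p)
      ultimately show ?thesis using Cons.IH[of u "A - {v}"] True uv 3 by (auto simp: Let_def)
    qed
  next
    case False
    then show ?thesis using Cons by (auto simp: p)
  qed
qed

text \<open>The sets left available differ by one node, so, allowing for \<open>z\<close>, the
  number of covered nodes is unchanged or drops by two.\<close>

lemma card_covered_greedy_remove:
  assumes "finite A" "z \<in> A"
  shows "card (covered (greedy E (A - {z}) L)) \<le> card (covered (greedy E A L))"
proof -
  let ?C = "covered (greedy E A L)" and ?C' = "covered (greedy E (A - {z}) L)"
  have sub: "?C \<subseteq> A" "?C' \<subseteq> A - {z}" by (rule covered_greedy)+
  have fin: "finite ?C" "finite ?C'" using sub assms(1) by (auto intro: finite_subset)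
  have cards: "card (A - ?C) + card ?C = card A"
    using card_Diff_subset[OF fin(1) sub(1)] card_mono[OF assms(1) sub(1)] by linarith
  have "card (A - {z} - ?C') + card ?C' = card (A - {z})"
    using card_Diff_subset[OF fin(2) sub(2)] card_mono[OF _ sub(2)] assms(1) by simp
  with card_Suc_Diff1[OF assms] have cards': "card (A - {z} - ?C') + card ?C' + 1 = card A" by linarith
  define C C' where "C = A - ?C" and "C' = A - {z} - ?C'"
  have fin': "finite C" "finite C'" using assms by (auto simp: C_def C'_def)
  obtain y where "y \<notin> C' \<and> C = insert y C' \<or> y \<notin> C \<and> C' = insert y C"
    using available_greedy_remove[OF assms(2), of L] unfolding Let_def C_def[symmetric] C'_def[symmetric] by blast
  then have "card C = card C' + 1 \<or> card C' = card C + 1"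
    using fin' by auto
  then show ?thesis using cards cards' unfolding C_def C'_def by linarith
qed

text \<open>Both nodes are left available by the full run only, and by
  \<open>available_greedy_remove\<close> there is at most one such node: the far end of the
  alternating path.\<close>

lemma newly_covered_unique:
  assumes "z \<in> A" "b \<in> covered (greedy E (A - {z}) L)" "b \<notin> covered (greedy E A L)"
    "b' \<in> covered (greedy E (A - {z}) L)" "b' \<notin> covered (greedy E A L)"
  shows "b = b'"
proof -
  define C C' where "C = A - covered (greedy E A L)" and "C' = A - {z} - covered (greedy E (A - {z}) L)"
  have "b \<in> C" "b' \<in> C" "b \<notin> C'" "b' \<notin> C'"
    using covered_greedy[of E "A - {z}" L] assms by (auto simp: C_def C'_def)
  moreover obtain y where "y \<notin> C' \<and> C = insert y C' \<or> y \<notin> C \<and> C' = insert y C"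
    using available_greedy_remove[OF assms(1), of L] unfolding Let_def C_def[symmetric] C'_def[symmetric] by blast
  ultimately show ?thesis by auto
qed

text \<open>The end of an alternating path depends only on its last part: if removing \<open>z\<close>
  makes \<open>q\<close> exchange its mate \<open>l\<close> for the formerly free node \<open>b\<close>, then so does removing
  \<open>l\<close>. In the induction the roles of the two runs get swapped, whence the second half.\<close>

lemma last_exchange:
  assumes "z \<in> A"
  shows "({q, b} \<in> greedy E (A - {z}) L \<longrightarrow> b \<notin> covered (greedy E A L) \<longrightarrow>
            {q, l} \<in> greedy E A L \<longrightarrow> {q, b} \<in> greedy E (A - {l}) L) \<and>
         ({q, b} \<in> greedy E A L \<longrightarrow> b \<notin> covered (greedy E (A - {z}) L) \<longrightarrow> b \<noteq> z \<longrightarrow>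
            {q, l} \<in> greedy E (A - {z}) L \<longrightarrow> {q, b} \<in> greedy E (A - {z} - {l}) L)"
  using assms
proof (induction L arbitrary: A z)
  case (Cons p L)
  obtain u v where p: "p = (u, v)" by fastforce
  show ?case
  proof (cases "u \<in> A \<and> v \<in> A \<and> {u, v} \<in> E")
    case True
    then have uv: "u \<noteq> v" using edge_neq by blast
    \<comment> \<open>Here the full run matches the deleted node \<open>u'\<close> to
      \<open>v'\<close>, so the tails run on \<open>A - {u'} - {v'}\<close> and
      \<open>A - {u'}\<close>. Each half of the claim follows from the opposite half of the
      induction hypothesis for \<open>v'\<close>.\<close>
    have swap: ?thesis if z: "z = u'" and uv': "{u', v'} = {u, v}" "u' \<noteq> v'" for u' v'
    proof -
      have 1: "greedy E A (p # L) = insert {u', v'} (greedy E (A - {u'} - {v'}) L)"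
        using True uv' by (simp add: p Diff_insert2[symmetric] insert_commute)
      have 2: "greedy E (A - {u'}) (p # L) = greedy E (A - {u'}) L"
        using uv' by (auto simp: p)
      have 3: "greedy E (A - {l}) (p # L) = insert {u', v'} (greedy E (A - {u'} - {v'} - {l}) L)"
        if "l \<noteq> u'" "l \<noteq> v'"
      proof -
        have "A - {l} - {u, v} = A - {u'} - {v'} - {l}" using uv' by auto
        moreover have "u \<noteq> l" "v \<noteq> l" using that uv' by auto
        ultimately show ?thesis using True uv' by (simp add: p)
      qed
      have 4: "greedy E (A - {u'} - {l}) (p # L) = greedy E (A - {u'} - {l}) L"
        using uv' by (auto simp: p)
      have v': "v' \<in> A - {u'}" using True uv' by (auto simp: doubleton_eq_iff)
      note IH = Cons.IH[OF v']
      have g: "x \<in> A \<and> x \<noteq> u' \<and> x \<noteq> v' \<and> y \<noteq> u' \<and> y \<noteq> v'"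
        if "{x, y} \<in> greedy E (A - {u'} - {v'}) L" for x y
        using greedy_edgeD[OF that] by auto
      have g': "x \<noteq> u' \<and> y \<noteq> u'" if "{x, y} \<in> greedy E (A - {u'}) L" for x y
        using greedy_edgeD[OF that] by auto
      show ?thesis
        unfolding z 2 4
      proof (intro conjI impI)
        assume h: "{q, b} \<in> greedy E (A - {u'}) L" "b \<notin> covered (greedy E A (p # L))"
          "{q, l} \<in> greedy E A (p # L)"
        have b: "b \<notin> covered (greedy E (A - {u'} - {v'}) L)" "b \<noteq> v'" using h(2) by (auto simp: 1)
        consider "{q, l} = {u', v'}" | "{q, l} \<in> greedy E (A - {u'} - {v'}) L"
          using h(3) by (auto simp: 1)
        then show "{q, b} \<in> greedy E (A - {l}) (p # L)"
        proof cases
          case 1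
          then have "l = u'" using g'[OF h(1)] by (auto simp: doubleton_eq_iff)
          then show ?thesis using h(1) 2 by simp
        next
          case 2
          then have "l \<noteq> u'" "l \<noteq> v'" using g[OF 2] by auto
          then show ?thesis using IH h(1) b 2 3 by auto
        qed
      next
        assume h: "{q, b} \<in> greedy E A (p # L)" "b \<notin> covered (greedy E (A - {u'}) L)" "b \<noteq> u'"
          "{q, l} \<in> greedy E (A - {u'}) L"
        have "{q, b} \<noteq> {u', v'}" using h(3) g'[OF h(4)] by (auto simp: doubleton_eq_iff)
        then have "{q, b} \<in> greedy E (A - {u'} - {v'}) L" using h(1) by (auto simp: 1)
        then show "{q, b} \<in> greedy E (A - {u'} - {l}) L" using IH h by blast
      qed
    qed
    show ?thesis
    proof (cases "z = u \<or> z = v")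
      case True
      then show ?thesis using swap[of u v] swap[of v u] uv by (auto simp: insert_commute)
    next
      case z: False
      have 1: "greedy E (A - X) (p # L) = insert {u, v} (greedy E (A - {u, v} - X) L)"
        if "u \<notin> X" "v \<notin> X" for X
      proof -
        have "A - X - {u, v} = A - {u, v} - X" by auto
        then show ?thesis using True that by (simp add: p)
      qed
      note IH = Cons.IH[of z "A - {u, v}"]
      have g: "x \<noteq> u \<and> x \<noteq> v \<and> y \<noteq> u \<and> y \<noteq> v"
        if "{x, y} \<in> greedy E (A - {u, v} - X) L" for x y X
        using greedy_edgeD[OF that] by auto
      have M: "greedy E A (p # L) = insert {u, v} (greedy E (A - {u, v}) L)" using 1[of "{}"] by simp
      have M': "greedy E (A - {z}) (p # L) = insert {u, v} (greedy E (A - {u, v} - {z}) L)"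
        using 1[of "{z}"] z by auto
      have N: "greedy E (A - {l}) (p # L) = insert {u, v} (greedy E (A - {u, v} - {l}) L)"
        "greedy E (A - {z} - {l}) (p # L) = insert {u, v} (greedy E (A - {u, v} - {z} - {l}) L)"
        if "l \<noteq> u" "l \<noteq> v"
        using 1[of "{l}"] 1[of "{z, l}"] that z by (auto simp: Diff_insert2[symmetric])
      have z': "z \<in> A - {u, v}" using Cons.prems z by auto
      \<comment> \<open>The pair \<open>{u, v}\<close> is matched in both runs. As \<open>y\<close>
        is free in one of them, \<open>y\<close>, then its partner \<open>x\<close>, then
        \<open>l\<close> lie outside \<open>{u, v}\<close>.\<close>
      have aux: "{x, y} \<in> N \<and> l \<noteq> u \<and> l \<noteq> v \<and> {x, l} \<in> N'"
        if "{x, y} \<in> insert {u, v} N" "y \<notin> covered (insert {u, v} N'')" "{x, l} \<in> insert {u, v} N'"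
          "N = greedy E (A - {u, v} - X) L" "N' = greedy E (A - {u, v} - X') L" for x y N N' N'' X X'
      proof -
        have "y \<noteq> u" "y \<noteq> v" using that by auto
        then have "{x, y} \<in> N" using that(1) by (auto simp: doubleton_eq_iff)
        then have "x \<noteq> u" "x \<noteq> v" using g that(4) by auto
        then have "{x, l} \<in> N'" using that(3) by (auto simp: doubleton_eq_iff)
        then show ?thesis using \<open>{x, y} \<in> N\<close> g that(5) by auto
      qed
      show ?thesis
      proof (intro conjI impI)
        assume h: "{q, b} \<in> greedy E (A - {z}) (p # L)" "b \<notin> covered (greedy E A (p # L))"
          "{q, l} \<in> greedy E A (p # L)"
        show "{q, b} \<in> greedy E (A - {l}) (p # L)"
        proof -
          have "{q, b} \<in> greedy E (A - {u, v} - {z}) L \<and> l \<noteq> u \<and> l \<noteq> v \<and> {q, l} \<in> greedy E (A - {u, v}) L"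
            by (rule aux[of q b _ _ _ "{z}" "{}"]) (use h in \<open>simp_all only: M M' Diff_empty\<close>)
          then show ?thesis using IH[OF z'] h(2) N by (simp add: M)
        qed
      next
        assume h: "{q, b} \<in> greedy E A (p # L)" "b \<notin> covered (greedy E (A - {z}) (p # L))" "b \<noteq> z"
          "{q, l} \<in> greedy E (A - {z}) (p # L)"
        show "{q, b} \<in> greedy E (A - {z} - {l}) (p # L)"
        proof -
          have "{q, b} \<in> greedy E (A - {u, v}) L \<and> l \<noteq> u \<and> l \<noteq> v \<and> {q, l} \<in> greedy E (A - {u, v} - {z}) L"
            by (rule aux[of q b _ _ _ "{}" "{z}"]) (use h in \<open>simp_all only: M M' Diff_empty\<close>)
          then show ?thesis using IH[OF z'] h(2,3) N by (simp add: M')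
        qed
      qed
    qed
  next
    case False
    then have "greedy E (A - X) (p # L) = greedy E (A - X) L" for X by (auto simp: p)
    from this[of "{}"] this[of "{z}"] this[of "{l}"] this[of "insert z {l}"]
    show ?thesis using Cons.IH[OF Cons.prems] by (simp add: Diff_insert2[symmetric])
  qed
qed simp

text \<open>The members of \<open>R\<close> are the nodes that stay unmatched when they are moved to the end.\<close>

lemma boundary_count:
  assumes fin: "finite A"
    and total: "\<And>x y. x \<in> A \<Longrightarrow> y \<in> A \<Longrightarrow> x \<noteq> y \<Longrightarrow> (x, y) \<in> set L \<or> (y, x) \<in> set L"
    and m: "\<And>u. u \<in> A \<Longrightarrow> m u \<in> A \<and> {u, m u} \<in> E \<and> m (m u) = u"
    and R: "R \<subseteq> A" "\<And>u v. u \<in> R \<Longrightarrow> v \<in> A \<Longrightarrow> {u, v} \<in> E \<Longrightarrow> v \<in> covered (greedy E (A - {u}) L)"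
  shows "2 * card R \<le> 3 * card (covered (greedy E A L))"
proof -
  define M where "M = greedy E A L"
  define C where "C = covered M"
  have CA: "C \<subseteq> A" unfolding C_def M_def by (rule covered_greedy)
  have finC: "finite C" using fin CA by (rule rev_finite_subset)
  have maxi: "x \<in> C \<or> y \<in> C" if "x \<in> A" "y \<in> A" "{x, y} \<in> E" for x y
    unfolding C_def M_def using greedy_maximal total that edge_neq by metis
  have inj_m: "u = v" if "u \<in> A" "v \<in> A" "m u = m v" for u v
    using m that by metis
  define D where "D = {a \<in> R \<inter> C. m a \<notin> C}"
  have new: "b = b'" if "z \<in> A" "b \<in> covered (greedy E (A - {z}) L)" "b \<notin> C"
    "b' \<in> covered (greedy E (A - {z}) L)" "b' \<notin> C" for z b b'
    using newly_covered_unique that unfolding C_def M_def by blast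
  have DR: "a \<in> R" "a \<in> A" "a \<in> C" "m a \<notin> C" "m a \<in> covered (greedy E (A - {a}) L)" if "a \<in> D" for a
    using that R m unfolding D_def by auto
  \<comment> \<open>The alternating path from \<open>a\<close> ends in \<open>l\<close>,
    \<open>q\<close>, \<open>m a\<close>: once \<open>a\<close> is deleted, the formerly free
    \<open>m a\<close> gets \<open>q\<close>, the old partner of \<open>l\<close>.\<close>
  have "\<exists>q l. {q, m a} \<in> greedy E (A - {a}) L \<and> {q, l} \<in> M" if a: "a \<in> D" for a
  proof -
    obtain q where q: "{m a, q} \<in> greedy E (A - {a}) L" using DR(5)[OF a] by (rule covered_greedyE)
    have "q \<in> C" using maxi[of q "m a"] greedy_edgeD[OF q] DR(4)[OF a] by (auto simp: insert_commute)
    then obtain l where "{q, l} \<in> M" unfolding C_def M_def by (rule covered_greedyE)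
    then show ?thesis using q by (metis insert_commute)
  qed
  then obtain q l where ql: "\<And>a. a \<in> D \<Longrightarrow> {q a, m a} \<in> greedy E (A - {a}) L"
    "\<And>a. a \<in> D \<Longrightarrow> {q a, l a} \<in> M" by metis
  have qlC: "q a \<in> C" "l a \<in> C" if "a \<in> D" for a
    using ql(2)[OF that] by (auto simp: C_def intro: coveredI)
  have qE: "{q a, m a} \<in> E" if "a \<in> D" for a
    using greedy_edgeD[OF ql(1)[OF that]] by blast
  have uniq: "y = z" if "{x, y} \<in> M" "{x, z} \<in> M" for x y z
    using greedy_partner_unique that unfolding M_def by blast
  \<comment> \<open>By \<open>last_exchange\<close>, deleting \<open>l a\<close> also ends in
    covering \<open>m a\<close>; so by \<open>new\<close> the node \<open>l a\<close> determines
    \<open>m a\<close>, hence \<open>a\<close>.\<close>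
  have nontriv: "m a \<in> covered (greedy E (A - {l a}) L)" if a: "a \<in> D" for a
  proof -
    have "{q a, m a} \<in> greedy E (A - {l a}) L"
      using last_exchange[OF DR(2)[OF a]] ql[OF a] DR(4)[OF a] unfolding C_def M_def by blast
    then show ?thesis by (rule coveredI)
  qed
  \<comment> \<open>Otherwise deleting \<open>l a\<close> would newly cover both
    \<open>m (l a)\<close> and \<open>m a\<close>, which \<open>new\<close> forces to be
    equal.\<close>
  have l_notin: "l a \<notin> D" if a: "a \<in> D" "l a \<noteq> a" for a
  proof
    assume l: "l a \<in> D"
    have "m (l a) = m a"
      by (rule new[OF DR(2)[OF l] DR(5)[OF l] DR(4)[OF l] nontriv[OF a(1)] DR(4)[OF a(1)]])
    then show False using inj_m[of "l a" a] DR(2)[OF l] DR(2)[OF a(1)] a(2) by blast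
  qed
  \<comment> \<open>\<open>m a\<close> is a neighbour of \<open>q a\<close>. If \<open>q a\<close>
    lay in \<open>D\<close>, its deletion would newly cover both \<open>m a\<close> and
    \<open>m (q a)\<close>.\<close>
  have q_notin: "q a \<notin> D" if a: "a \<in> D" for a
  proof
    assume q: "q a \<in> D"
    have 1: "m a \<in> covered (greedy E (A - {q a}) L)"
      using R(2)[OF DR(1)[OF q] _ qE[OF a]] m DR(2)[OF a] by blast
    have "m (q a) = m a"
      by (rule new[OF DR(2)[OF q] DR(5)[OF q] DR(4)[OF q] 1 DR(4)[OF a]])
    then have "q a = a" using inj_m[of "q a" a] DR(2)[OF q] DR(2)[OF a] by blast
    then show False using greedy_edgeD[OF ql(1)[OF a]] by auto
  qed
  define f where "f a = (if l a = a then q a else l a)" for a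
  have f_sub: "f ` D \<subseteq> C - D"
    using l_notin q_notin qlC by (auto simp: f_def)
  \<comment> \<open>\<open>q a = l b\<close> makes \<open>q b = a\<close>, so \<open>m b\<close> is
    a neighbour of \<open>a \<in> R\<close> and, like \<open>m a\<close>, is newly covered when
    \<open>a\<close> is deleted.\<close>
  have mixed: False if a: "a \<in> D" "l a = a" and b: "b \<in> D" "l b \<noteq> b" and eq: "q a = l b" for a b
  proof -
    have "{l b, a} \<in> M" using ql(2)[OF a(1)] a(2) eq by simp
    moreover have "{l b, q b} \<in> M" using ql(2)[OF b(1)] by (simp add: insert_commute)
    ultimately have "q b = a" using uniq by blast
    then have "{a, m b} \<in> E" using qE[OF b(1)] by simp
    then have 1: "m b \<in> covered (greedy E (A - {a}) L)"
      using R(2)[OF DR(1)[OF a(1)]] m DR(2)[OF b(1)] by blast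
    have "m a = m b"
      by (rule new[OF DR(2)[OF a(1)] DR(5)[OF a(1)] DR(4)[OF a(1)] 1 DR(4)[OF b(1)]])
    then have "a = b" using inj_m[of a b] DR(2)[OF a(1)] DR(2)[OF b(1)] by blast
    then show False using a b by simp
  qed
  have f_inj: "inj_on f D"
  proof (rule inj_onI)
    fix a b assume ab: "a \<in> D" "b \<in> D" "f a = f b"
    consider "l a = a" "l b = b" | "l a = a" "l b \<noteq> b" | "l a \<noteq> a" "l b = b" | "l a \<noteq> a" "l b \<noteq> b"
      by blast
    then show "a = b"
    proof cases
      case 1
      then have "q a = q b" using ab(3) by (simp add: f_def)
      then show ?thesis using ql(2)[OF ab(1)] ql(2)[OF ab(2)] 1 uniq by metis
    next
      case 2
      then show ?thesis using mixed[of a b] ab by (auto simp: f_def)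
    next
      case 3
      then show ?thesis using mixed[of b a] ab by (auto simp: f_def)
    next
      case 4
      then have eq: "l a = l b" using ab(3) by (simp add: f_def)
      have "l a \<in> A" using qlC(2)[OF ab(1)] CA by blast
      from new[OF this nontriv[OF ab(1)] DR(4)[OF ab(1)]] nontriv[OF ab(2)] DR(4)[OF ab(2)] eq
      have "m a = m b" by simp
      then show ?thesis using inj_m[of a b] DR(2)[OF ab(1)] DR(2)[OF ab(2)] by blast
    qed
  qed
  have "D \<subseteq> C" by (auto simp: D_def)
  then have "card D + card (C - D) = card C"
    using finC by (metis add.commute card_Diff_subset card_mono finite_subset le_add_diff_inverse2)
  moreover have "card D \<le> card (C - D)"
    using card_image[OF f_inj] card_mono[OF _ f_sub] finC by simp
  ultimately have D2: "2 * card D \<le> card C" by linarith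
  have m_sub: "m ` (A - C) \<subseteq> C"
    using maxi m by blast
  have "card (m ` (A - C)) = card (A - C)"
    by (rule card_image) (use inj_m in \<open>auto simp: inj_on_def\<close>)
  moreover have "card (C - m ` (A - C)) + card (m ` (A - C)) = card C"
    using m_sub finC card_Diff_subset[of "m ` (A - C)" C] card_mono[OF finC m_sub] finite_subset[OF m_sub finC]
    by simp
  \<comment> \<open>A matched member of \<open>R\<close> with a free mate is in \<open>D\<close>.
    The sizes of the three sets add up to \<open>|C| + |D|\<close>, since \<open>m\<close> maps the
    free nodes injectively into \<open>C\<close>.\<close>
  moreover have "R \<subseteq> (A - C) \<union> (C - m ` (A - C)) \<union> D"
  proof
    fix u assume u: "u \<in> R"
    then have uA: "u \<in> A" using R(1) by blast
    show "u \<in> (A - C) \<union> (C - m ` (A - C)) \<union> D"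
    proof (cases "u \<in> m ` (A - C)")
      case True
      then have "m u \<notin> C" using m by auto
      then show ?thesis using u uA by (auto simp: D_def)
    qed (use uA in auto)
  qed
  then have "card R \<le> card ((A - C) \<union> (C - m ` (A - C)) \<union> D)"
    using fin finC \<open>D \<subseteq> C\<close> by (intro card_mono) (auto intro: finite_subset)
  then have "card R \<le> card (A - C) + card (C - m ` (A - C)) + card D"
    using card_Un_le[of "A - C" "C - m ` (A - C)"] card_Un_le[of "(A - C) \<union> (C - m ` (A - C))" D]
    by linarith
  ultimately show ?thesis using D2 unfolding C_def M_def by linarith
qed

end

section \<open>The linear program\<close>

text \<open>Equality holds throughout for \<open>y s = s / (n - 1)\<close>.\<close>

lemma lp_partial_sum:
  fixes y :: "nat \<Rightarrow> real"
  assumes "n \<ge> 2"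
    and "\<And>s. s < n \<Longrightarrow> real (n - s) * y s + 2 * (\<Sum>i<s. y i) \<le> s"
  shows "s \<le> n - 1 \<Longrightarrow> 2 * (real n - 1) * (\<Sum>i<s. y i) \<le> real s * (real s - 1)"
proof (induction s)
  case (Suc s)
  define Y where "Y = (\<Sum>i<s. y i)"
  define d where "d = real n - real s"
  have d: "d \<ge> 2" using Suc.prems by (simp add: d_def)
  have n1: "real n - 1 > 0" using assms(1) by simp
  have IH: "2 * (real n - 1) * Y \<le> real s * (real s - 1)" using Suc by (simp add: Y_def)
  have "d * y s + 2 * Y \<le> s" using assms(2)[of s] Suc.prems by (simp add: Y_def d_def of_nat_diff)
  then have "2 * (real n - 1) * (d * y s + 2 * Y) \<le> 2 * (real n - 1) * s"
    using n1 by (intro mult_left_mono) auto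
  \<comment> \<open>\<open>d * (Y + y s)\<close> equals
    \<open>(d * y s + 2 * Y) + (d - 2) * Y\<close>, and \<open>d - 2\<close> is nonnegative because
    \<open>Suc s \<le> n - 1\<close>.\<close>
  moreover have "(d - 2) * (2 * (real n - 1) * Y) \<le> (d - 2) * (real s * (real s - 1))"
    using IH d by (intro mult_left_mono) auto
  ultimately have "d * (2 * (real n - 1) * (Y + y s)) \<le> 2 * (real n - 1) * s + (d - 2) * (real s * (real s - 1))"
    by (simp add: algebra_simps)
  also have "\<dots> = d * (real (Suc s) * (real (Suc s) - 1))"
    by (simp add: d_def algebra_simps)
  finally show ?case using d by (simp add: Y_def)
qed simp

text \<open>The sum is cut where the extremal sequence reaches \<open>c\<close>:
  \<open>lp_partial_sum\<close> bounds the part before the cut, \<open>y i \<le> c\<close> the part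
  after it.\<close>

lemma lp_bound:
  fixes y :: "nat \<Rightarrow> real"
  assumes n: "n \<ge> 2"
    and nonneg: "\<And>s. s < n \<Longrightarrow> 0 \<le> y s"
    and le1: "y (n - 1) \<le> 1"
    and mono: "\<And>s. s < n \<Longrightarrow> y s \<le> y (n - 1)"
    and evolve: "\<And>s. s < n \<Longrightarrow> real (n - s) * y s + 2 * (\<Sum>i<s. y i) \<le> s"
    and boundary: "2 * (real n * y (n - 1)) \<le> 3 * (real n - (\<Sum>i<n. y i))"
  shows "real n - (\<Sum>i<n. y i) \<ge> 2 * (5 - sqrt 7) / 9 * n"
proof -
  define c where "c = y (n - 1)"
  define S where "S = (\<Sum>i<n. y i)"
  define w where "w = (real n - 1) * c"
  define s where "s = nat \<lceil>w\<rceil>" \<comment> \<open>where the extremal \<open>y i = i / (n - 1)\<close> reaches \<open>c\<close>\<close>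
  have c: "0 \<le> c" "c \<le> 1" using nonneg[of "n - 1"] le1 n by (auto simp: c_def)
  have n1: "real n - 1 > 0" using n by simp
  have w: "0 \<le> w" "w \<le> real n - 1" using c n1 by (auto simp: w_def mult_left_le)
  define d where "d = real s - w"
  have d: "0 \<le> d" "d \<le> 1" using w(1) by (auto simp: d_def s_def) linarith+
  have "\<lceil>w\<rceil> \<le> int (n - 1)" using w(2) n by (intro ceiling_le) (simp add: of_nat_diff)
  then have sn: "s \<le> n - 1" by (simp add: s_def nat_le_iff)
  have "S = (\<Sum>i<s. y i) + (\<Sum>i=s..<n. y i)"
    using sn n unfolding S_def by (metis diff_le_self le_trans lessThan_atLeast0 sum.atLeastLessThan_concat zero_le)
  moreover have "(\<Sum>i=s..<n. y i) \<le> real (card {s..<n}) * c"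
    using mono unfolding c_def by (intro sum_bounded_above) auto
  then have "(\<Sum>i=s..<n. y i) \<le> (real n - s) * c" using sn n by (simp add: of_nat_diff)
  ultimately have "S \<le> (\<Sum>i<s. y i) + (real n - s) * c" by linarith
  then have "2 * (real n - 1) * S \<le> 2 * (real n - 1) * ((\<Sum>i<s. y i) + (real n - s) * c)"
    using n1 by (intro mult_left_mono) auto
  also have "\<dots> \<le> real s * (real s - 1) + 2 * (real n - s) * w"
    using lp_partial_sum[OF n evolve sn] by (simp add: w_def algebra_simps)
  \<comment> \<open>With \<open>s = w + d\<close> the rounding term \<open>d * (1 - d)\<close> has
    the favourable sign, so the bound holds for every \<open>n\<close> and not only in the
    limit.\<close>
  also have "\<dots> = 2 * (real n - 1) * (real n * (c - c\<^sup>2 / 2)) - d * (1 - d) - w * (1 - c)"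
    by (simp add: d_def w_def power2_eq_square field_simps)
  also have "\<dots> \<le> 2 * (real n - 1) * (real n * (c - c\<^sup>2 / 2))"
    using mult_nonneg_nonneg[of d "1 - d"] mult_nonneg_nonneg[of w "1 - c"] d c w by linarith
  finally have S: "S \<le> real n * (c - c\<^sup>2 / 2)" using n1 by simp
  define q where "q = S / n"
  have q1: "q \<le> c - c\<^sup>2 / 2" using S n by (simp add: q_def field_simps)
  have q2: "2 * c \<le> 3 * (1 - q)" using boundary n by (simp add: q_def c_def S_def field_simps)
  have "q \<le> (2 * sqrt 7 - 1) / 9"
  proof (rule ccontr)
    assume q: "\<not> ?thesis"
    \<comment> \<open>\<open>c0\<close> is the smaller root of
      \<open>2 * c = 3 * (1 - (c - c\<^sup>2 / 2))\<close>. Below 1 the function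
      \<open>c - c\<^sup>2 / 2\<close> increases, so \<open>c < c0\<close> bounds \<open>q\<close>
      by the value at \<open>c0\<close>.\<close>
    define c0 where "c0 = (5 - sqrt 7) / 3"
    have r: "sqrt 7 * sqrt 7 = 7" by simp
    have "sqrt 7 > 2" by (rule real_less_rsqrt) simp
    then have c0: "c0 < 1" by (simp add: c0_def)
    have "c < c0" using q q2 by (simp add: c0_def)
    have "0 \<le> (c0 - c) * (1 - (c0 + c) / 2)"
      using \<open>c < c0\<close> c0 by (intro mult_nonneg_nonneg) auto
    also have "\<dots> = (c0 - c0\<^sup>2 / 2) - (c - c\<^sup>2 / 2)" by (simp add: power2_eq_square field_simps)
    finally have "c - c\<^sup>2 / 2 \<le> c0 - c0\<^sup>2 / 2" by simp
    also have "\<dots> = (2 * sqrt 7 - 1) / 9"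
      using r by (simp add: c0_def power2_eq_square field_simps)
    finally show False using q q1 by simp
  qed
  then show ?thesis using n by (simp add: q_def S_def field_simps)
qed

section \<open>Permutations as lists\<close>

lemma permutations_of_set_nth_split:
  assumes "l \<in> permutations_of_set A" "i < card A"
  shows "removeAll (l ! i) l = take i l @ drop (Suc i) l" "insert_nth i (l ! i) (removeAll (l ! i) l) = l"
    "l ! i \<in> A" "removeAll (l ! i) l \<in> permutations_of_set (A - {l ! i})"
proof -
  have l: "set l = A" "distinct l" "i < length l"
    using assms by (auto simp: permutations_of_set_def distinct_card[symmetric])
  have l_eq: "l = take i l @ l ! i # drop (Suc i) l" using l(3) by (rule id_take_nth_drop)
  have d: "distinct (take i l @ l ! i # drop (Suc i) l)" using l(2) l_eq by simp
  have "removeAll (l ! i) l = removeAll (l ! i) (take i l @ l ! i # drop (Suc i) l)" using l_eq by simp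
  also have "\<dots> = take i l @ drop (Suc i) l" using d by simp
  finally show 1: "removeAll (l ! i) l = take i l @ drop (Suc i) l" .
  show "insert_nth i (l ! i) (removeAll (l ! i) l) = l"
    unfolding 1 insert_nth_def using l(3) l_eq by simp
  show "l ! i \<in> A" using l by auto
  show "removeAll (l ! i) l \<in> permutations_of_set (A - {l ! i})"
    using l by (auto simp: permutations_of_set_def distinct_removeAll)
qed

lemma insert_nth_permutation:
  assumes "u \<in> A" "t \<in> permutations_of_set (A - {u})" "i < card A"
  shows "insert_nth i u t \<in> permutations_of_set A" "insert_nth i u t ! i = u"
    "removeAll u (insert_nth i u t) = t"
proof -
  have t: "set t = A - {u}" "distinct t" using assms(2) by (auto simp: permutations_of_set_def)
  have "finite A" using assms(3) card.infinite by fastforce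
  then have len: "i \<le> length t" using t assms(1,3) distinct_card[of t] by simp
  have tt: "take i t @ drop i t = t" by simp
  have "set (take i t) \<union> set (drop i t) = A - {u}" using t(1) by (metis tt set_append)
  moreover have "set (take i t) \<inter> set (drop i t) = {}" using t(2) by (metis tt distinct_append)
  ultimately show "insert_nth i u t \<in> permutations_of_set A"
    using assms(1) t(2) by (auto simp: permutations_of_set_def insert_nth_def)
  show "insert_nth i u t ! i = u" using len by (simp add: insert_nth_def nth_append)
  have "u \<notin> set (take i t)" "u \<notin> set (drop i t)"
    using t by (auto dest: in_set_takeD in_set_dropD)
  then show "removeAll u (insert_nth i u t) = t" by (simp add: insert_nth_def)
qed

text \<open>The right side is free of \<open>i\<close>: the node at any position is uniformly
  random, with a uniformly random order of the others.\<close>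

lemma sum_permutations_nth:
  fixes f :: "'a \<Rightarrow> 'a list \<Rightarrow> real"
  assumes "i < card A"
  shows "(\<Sum>l\<in>permutations_of_set A. f (l ! i) (removeAll (l ! i) l)) =
    (\<Sum>u\<in>A. \<Sum>t\<in>permutations_of_set (A - {u}). f u t)"
proof -
  have "finite A" using assms card.infinite by fastforce
  then have "(\<Sum>u\<in>A. \<Sum>t\<in>permutations_of_set (A - {u}). f u t) =
    (\<Sum>(u, t)\<in>Sigma A (\<lambda>u. permutations_of_set (A - {u})). f u t)"
    by (intro sum.Sigma) auto
  also have "\<dots> = (\<Sum>l\<in>permutations_of_set A. f (l ! i) (removeAll (l ! i) l))"
    by (rule sum.reindex_bij_witness[of _ "\<lambda>l. (l ! i, removeAll (l ! i) l)" "\<lambda>(u, t). insert_nth i u t"])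
      (use assms in \<open>auto simp: permutations_of_set_nth_split(2-4) insert_nth_permutation\<close>)
  finally show ?thesis by simp
qed

section \<open>Moving one node\<close>

lemma find_append: "find P (xs @ ys) = (case find P xs of None \<Rightarrow> find P ys | Some x \<Rightarrow> Some x)"
  by (induction xs) auto

lemma greedy_skip: "x \<notin> A \<Longrightarrow> greedy E A (map (Pair x) zs @ L) = greedy E A L"
  by (induction zs) auto

lemma greedy_scan:
  assumes "x \<in> A"
  shows "greedy E A (map (Pair x) zs @ L) =
    (case find (\<lambda>y. y \<in> A \<and> {x, y} \<in> E) zs of None \<Rightarrow> greedy E A L
     | Some y \<Rightarrow> insert {x, y} (greedy E (A - {x, y}) L))"
  using assms by (induction zs) (auto simp: greedy_skip)

lemma covered_greedy_lex_pairs: "covered (greedy E A (lex_pairs xs)) \<subseteq> set xs"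
proof -
  have "covered (greedy E A L) \<subseteq> fst ` set L \<union> snd ` set L" for L
    by (induction E A L rule: greedy.induct) auto
  then show ?thesis using set_lex_pairs_subset[of xs] by fastforce
qed

lemma greedy_remove_uncovered:
  "u \<notin> covered (greedy E A L) \<Longrightarrow> greedy E (A - {u}) L = greedy E A L"
proof (induction L arbitrary: A)
  case (Cons p L)
  obtain x y where p: "p = (x, y)" by fastforce
  have "A - {u} - {x, y} = A - {x, y} - {u}" by auto
  then show ?case using Cons.IH[of A] Cons.IH[of "A - {x, y}"] Cons.prems by (auto simp: p split: if_splits)
qed simp

context simple_edges
begin

text \<open>If no partner of a neighbour \<open>v\<close> in the run without \<open>u\<close>
  precedes \<open>u\<close>, then \<open>{u, v}\<close> is probed before \<open>v\<close> is taken.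
  The position of \<open>u\<close> enters only through \<open>set xs\<close>, which gives
  monotonicity in the position and the charging argument.\<close>

lemma uncovered_insert_iff:
  assumes "u \<in> A" "distinct (xs @ u # ys)"
  shows "u \<notin> covered (greedy E A (lex_pairs (xs @ u # ys))) \<longleftrightarrow>
    (\<forall>v\<in>A \<inter> set (xs @ ys). {u, v} \<in> E \<longrightarrow>
      (\<exists>w\<in>set xs. {v, w} \<in> greedy E (A - {u}) (lex_pairs (xs @ ys))))"
  using assms
proof (induction xs arbitrary: A)
  case Nil
  have u: "u \<notin> covered (greedy E A (lex_pairs ys))"
    using covered_greedy_lex_pairs[of E A ys] Nil.prems by auto
  show ?case
  proof (cases "find (\<lambda>y. y \<in> A \<and> {u, y} \<in> E) ys")
    case None
    then have "\<forall>v\<in>A \<inter> set ys. {u, v} \<notin> E" by (auto simp: find_None_iff)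
    then show ?thesis using u Nil.prems None by (simp add: greedy_scan)
  next
    case (Some y)
    then have "y \<in> A \<inter> set ys" "{u, y} \<in> E" by (auto simp: find_Some_iff)
    then show ?thesis using Nil.prems Some by (auto simp: greedy_scan)
  qed
next
  case (Cons x xs)
  have x: "x \<noteq> u" "x \<notin> set xs" "x \<notin> set ys" "u \<notin> set xs" "u \<notin> set ys"
    using Cons.prems by auto
  have nox: "{v, x} \<notin> greedy E B (lex_pairs (xs @ ys))" "{x, v} \<notin> greedy E B (lex_pairs (xs @ ys))" for v B
    using covered_greedy_lex_pairs[of E B "xs @ ys"] x coveredI[of v x] coveredI[of x v] by auto
  show ?case
  proof (cases "x \<in> A")
    case False
    then show ?thesis using Cons.IH[of A] Cons.prems nox by (auto simp: greedy_skip)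
  next
    case xA: True
    define P where "P = (\<lambda>y. y \<in> A \<and> {x, y} \<in> E)"
    define P' where "P' = (\<lambda>y. y \<in> A - {u} \<and> {x, y} \<in> E)"
    have PP': "find P' xs = find P xs" "find P' ys = find P ys"
      using x by (auto simp: P_def P'_def intro!: find_cong)
    have scan: "greedy E A (lex_pairs ((x # xs) @ u # ys)) =
        (case find P (xs @ u # ys) of None \<Rightarrow> greedy E A (lex_pairs (xs @ u # ys))
         | Some y \<Rightarrow> insert {x, y} (greedy E (A - {x, y}) (lex_pairs (xs @ u # ys))))"
      using greedy_scan[OF xA, of E "xs @ u # ys"] unfolding P_def by simp
    have scan': "greedy E (A - {u}) (lex_pairs ((x # xs) @ ys)) =
        (case find P' (xs @ ys) of None \<Rightarrow> greedy E (A - {u}) (lex_pairs (xs @ ys))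
         | Some y \<Rightarrow> insert {x, y} (greedy E (A - {u} - {x, y}) (lex_pairs (xs @ ys))))"
      using greedy_scan[of x "A - {u}" E "xs @ ys"] xA x(1) unfolding P'_def by simp
    \<comment> \<open>Both runs match \<open>x\<close> to the same \<open>y\<close>; the induction
      hypothesis is applied without these two nodes.\<close>
    have Some_case: ?thesis
      if f: "find P (xs @ u # ys) = Some y" "find P' (xs @ ys) = Some y" and y: "y \<noteq> u" for y
    proof -
      have yA: "y \<in> A" using f(1) by (auto simp: find_Some_iff P_def)
      have neq: "x \<noteq> y" using f(1) edge_neq by (auto simp: find_Some_iff P_def)
      have comm: "A - {u} - {x, y} = A - {x, y} - {u}" by auto
      define G where "G = greedy E (A - {x, y} - {u}) (lex_pairs (xs @ ys))"
      have G: "{x, w} \<notin> G" "{y, w} \<notin> G" "{w, x} \<notin> G" "{w, y} \<notin> G" for w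
        using greedy_edgeD[of _ _ E "A - {x, y} - {u}"] unfolding G_def by blast+
      have 1: "greedy E A (lex_pairs ((x # xs) @ u # ys)) =
          insert {x, y} (greedy E (A - {x, y}) (lex_pairs (xs @ u # ys)))"
        using scan f(1) by simp
      have 2: "greedy E (A - {u}) (lex_pairs ((x # xs) @ ys)) = insert {x, y} G"
        using scan' f(2) comm by (simp add: G_def)
      have IH: "u \<notin> covered (greedy E (A - {x, y}) (lex_pairs (xs @ u # ys))) \<longleftrightarrow>
        (\<forall>v\<in>(A - {x, y}) \<inter> set (xs @ ys). {u, v} \<in> E \<longrightarrow> (\<exists>w\<in>set xs. {v, w} \<in> G))"
        unfolding G_def by (rule Cons.IH) (use Cons.prems x y in auto)
      have L: "u \<notin> covered (greedy E A (lex_pairs ((x # xs) @ u # ys))) \<longleftrightarrow>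
        u \<notin> covered (greedy E (A - {x, y}) (lex_pairs (xs @ u # ys)))"
        unfolding 1 using x y by auto
      have mem: "(\<exists>w\<in>set (x # xs). {v, w} \<in> insert {x, y} G) \<longleftrightarrow> (\<exists>w\<in>set xs. {v, w} \<in> G)"
        if "v \<noteq> x" "v \<noteq> y" for v
        using that G by (auto simp: doubleton_eq_iff)
      have memy: "\<exists>w\<in>set (x # xs). {y, w} \<in> insert {x, y} G" by (auto simp: insert_commute)
      \<comment> \<open>If \<open>y\<close> came after \<open>u\<close>, then \<open>x\<close> would
        have taken its neighbour \<open>u\<close> instead.\<close>
      have memx: "\<exists>w\<in>set (x # xs). {x, w} \<in> insert {x, y} G" if "{u, x} \<in> E"
      proof -
        have "y \<in> set xs"
        proof (rule ccontr)
          assume "y \<notin> set xs"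
          then have "find P xs = None" using f(1) by (auto simp: find_append find_Some_iff split: option.splits)
          moreover have "P u" using that Cons.prems(1) by (simp add: P_def insert_commute)
          ultimately have "find P (xs @ u # ys) = Some u" by (simp add: find_append)
          then show False using f(1) y by simp
        qed
        then show ?thesis by auto
      qed
      define H where "H = (\<lambda>v. \<exists>w\<in>set (x # xs). {v, w} \<in> insert {x, y} G)"
      define K where "K = (\<lambda>v. \<exists>w\<in>set xs. {v, w} \<in> G)"
      have HK: "H v = K v" if "v \<noteq> x" "v \<noteq> y" for v
        unfolding H_def K_def using that by (rule mem)
      have Hy: "H y" using memy by (simp only: H_def)
      have Hx: "{u, x} \<in> E \<Longrightarrow> H x" using memx by (simp only: H_def)
      have "(\<forall>v\<in>(A - {x, y}) \<inter> set (xs @ ys). {u, v} \<in> E \<longrightarrow> K v) \<longleftrightarrow>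
          (\<forall>v\<in>A \<inter> set ((x # xs) @ ys). {u, v} \<in> E \<longrightarrow> H v)"
      proof (intro iffI ballI impI)
        fix v assume "\<forall>v\<in>(A - {x, y}) \<inter> set (xs @ ys). {u, v} \<in> E \<longrightarrow> K v"
          "v \<in> A \<inter> set ((x # xs) @ ys)" "{u, v} \<in> E"
        then show "H v" using HK[of v] Hx Hy by (cases "v = x"; cases "v = y") simp_all
      next
        fix v assume "\<forall>v\<in>A \<inter> set ((x # xs) @ ys). {u, v} \<in> E \<longrightarrow> H v"
          "v \<in> (A - {x, y}) \<inter> set (xs @ ys)" "{u, v} \<in> E"
        then show "K v" using HK[of v] by simp
      qed
      then show ?thesis unfolding L IH 2 H_def K_def .
    qed
    show ?thesis
    proof (cases "find P xs")
      case (Some y)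
      then have "y \<in> set xs" by (auto simp: find_Some_iff)
      then show ?thesis using Some_case[of y] Some PP' x by (auto simp: find_append)
    next
      case None
      show ?thesis
      proof (cases "P u")
        \<comment> \<open>The full run matches \<open>x\<close> to \<open>u\<close>. Without
          \<open>u\<close>, \<open>x\<close> gets a partner from \<open>ys\<close> or none, so
          \<open>x\<close> violates the right-hand side.\<close>
        case True
        then have "u \<in> covered (greedy E A (lex_pairs ((x # xs) @ u # ys)))"
          unfolding scan using None by (simp add: find_append)
        moreover have "{u, x} \<in> E" "x \<in> A \<inter> set ((x # xs) @ ys)"
          using True xA by (auto simp: P_def insert_commute)
        moreover have "{x, w} \<notin> greedy E (A - {u}) (lex_pairs ((x # xs) @ ys))"
          if w: "w \<in> set (x # xs)" for w
        proof
          assume xw: "{x, w} \<in> greedy E (A - {u}) (lex_pairs ((x # xs) @ ys))"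
          show False
          proof (cases "find P' (xs @ ys)")
            case None
            then show False using xw nox unfolding scan' by simp
          next
            case (Some y)
            then have "y \<in> set ys"
              using None PP' by (auto simp: find_append find_Some_iff)
            moreover have "{x, y} \<in> greedy E (A - {u}) (lex_pairs ((x # xs) @ ys))"
              unfolding scan' using Some by simp
            ultimately show False
              using greedy_partner_unique[OF xw] w Cons.prems by auto
          qed
        qed
        ultimately show ?thesis by blast
      next
        case nP: False
        then have ux: "{u, x} \<notin> E" using Cons.prems by (simp add: P_def insert_commute)
        show ?thesis
        proof (cases "find P ys")
          case (Some y)
          then have "y \<in> set ys" by (auto simp: find_Some_iff)
          then show ?thesis using Some_case[of y] None nP Some PP' x by (auto simp: find_append)
        next
          case Nys: None
          have 1: "greedy E A (lex_pairs ((x # xs) @ u # ys)) = greedy E A (lex_pairs (xs @ u # ys))"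
            unfolding scan using None nP Nys by (simp add: find_append)
          have 2: "greedy E (A - {u}) (lex_pairs ((x # xs) @ ys)) = greedy E (A - {u}) (lex_pairs (xs @ ys))"
            unfolding scan' using None Nys PP' by (simp add: find_append)
          have "u \<notin> covered (greedy E A (lex_pairs (xs @ u # ys))) \<longleftrightarrow>
            (\<forall>v\<in>A \<inter> set (xs @ ys). {u, v} \<in> E \<longrightarrow>
              (\<exists>w\<in>set xs. {v, w} \<in> greedy E (A - {u}) (lex_pairs (xs @ ys))))"
            by (rule Cons.IH) (use Cons.prems in auto)
          then show ?thesis unfolding 1 2 using ux nox by auto
        qed
      qed
    qed
  qed
qed

end

section \<open>Averaging over all permutations\<close>

definition total_covered :: "'a set set \<Rightarrow> 'a set \<Rightarrow> real" where
  "total_covered E A =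
    (\<Sum>l\<in>permutations_of_set A. real (card (covered (greedy E A (lex_pairs l)))))"

context simple_edges
begin

text \<open>The bound holds for each order of \<open>A\<close>, and each order of
  \<open>A - {w}\<close> comes from exactly \<open>card A\<close> orders of
  \<open>A\<close>.\<close>

lemma total_covered_remove:
  assumes "finite A" "w \<in> A"
  shows "card A * total_covered E (A - {w}) \<le> total_covered E A"
proof -
  define F where "F t = real (card (covered (greedy E (A - {w}) (lex_pairs t))))" for t
  have idx: "(\<Sum>i<card A. of_bool (l ! i = w)) = (1::real)" if l: "l \<in> permutations_of_set A" for l
  proof -
    have "set l = A" "distinct l" "length l = card A"
      using l by (auto simp: permutations_of_set_def distinct_card[symmetric])
    then obtain k where k: "k < card A" "l ! k = w" using assms(2) by (metis in_set_conv_nth)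
    have "(\<Sum>i<card A. of_bool (l ! i = w)) = (\<Sum>i<card A. of_bool (i = k) :: real)"
      using k \<open>distinct l\<close> \<open>length l = card A\<close> by (intro sum.cong) (auto simp: nth_eq_iff_index_eq)
    also have "\<dots> = 1" using k by (simp add: of_bool_def)
    finally show ?thesis .
  qed
  have "card A * total_covered E (A - {w}) =
    (\<Sum>i<card A. \<Sum>u\<in>A. \<Sum>t\<in>permutations_of_set (A - {u}). of_bool (u = w) * F t)"
  proof -
    have "(\<Sum>u\<in>A. \<Sum>t\<in>permutations_of_set (A - {u}). of_bool (u = w) * F t) =
        (\<Sum>u\<in>A. if u = w then \<Sum>t\<in>permutations_of_set (A - {w}). F t else 0)"
      by (intro sum.cong) auto
    also have "\<dots> = total_covered E (A - {w})"
      using assms by (simp add: total_covered_def F_def)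
    finally show ?thesis by simp
  qed
  also have "\<dots> = (\<Sum>i<card A. \<Sum>l\<in>permutations_of_set A. of_bool (l ! i = w) * F (removeAll (l ! i) l))"
    by (intro sum.cong refl sum_permutations_nth[symmetric]) simp
  also have "\<dots> = (\<Sum>l\<in>permutations_of_set A. \<Sum>i<card A. of_bool (l ! i = w) * F (removeAll (l ! i) l))"
    by (rule sum.swap)
  also have "\<dots> = (\<Sum>l\<in>permutations_of_set A. (\<Sum>i<card A. of_bool (l ! i = w)) * F (removeAll w l))"
    unfolding sum_distrib_right by (intro sum.cong) auto
  also have "\<dots> = (\<Sum>l\<in>permutations_of_set A. F l)"
    by (intro sum.cong refl) (simp only: idx F_def greedy_lex_pairs_removeAll mult_1)
  also have "\<dots> \<le> total_covered E A"
    unfolding total_covered_def F_def by (intro sum_mono) (simp add: card_covered_greedy_remove assms)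
  finally show ?thesis .
qed

text \<open>With \<open>B\<close> the set of nodes covered by a maximum matching, this is the
  reduction to a perfect matching.\<close>

lemma total_covered_subset:
  assumes "finite A" "B \<subseteq> A"
  shows "total_covered E B / fact (card B) \<le> total_covered E A / fact (card A)"
proof -
  have "finite (A - B)" using assms by simp
  then show ?thesis using assms
  proof (induction "A - B" arbitrary: A rule: finite_induct)
    case empty
    then show ?case by auto
  next
    case (insert w C)
    have w: "w \<in> A" "w \<notin> B" using insert.hyps by auto
    have "total_covered E B / fact (card B) \<le> total_covered E (A - {w}) / fact (card (A - {w}))"
      by (rule insert.hyps(3)) (use insert in auto)
    also have "\<dots> = card A * total_covered E (A - {w}) / fact (card A)"
    proof -
      have "card A = Suc (card (A - {w}))" using card_Suc_Diff1[OF insert.prems(1) w(1)] by simp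
      then show ?thesis by (simp del: of_nat_Suc)
    qed
    also have "\<dots> \<le> total_covered E A / fact (card A)"
      by (intro divide_right_mono total_covered_remove insert.prems w) simp
    finally show ?case .
  qed
qed

lemma total_covered_perfect:
  assumes fin: "finite A" and n: "card A \<ge> 2"
    and m: "\<And>u. u \<in> A \<Longrightarrow> m u \<in> A \<and> {u, m u} \<in> E \<and> m (m u) = u"
  shows "total_covered E A / fact (card A) \<ge> 2 * (5 - sqrt 7) / 9 * card A"
proof -
  define n where "n = card A"
  define P where "P = permutations_of_set A"
  define cov where "cov l = covered (greedy E A (lex_pairs l))" for l
  \<comment> \<open>Stated for an order \<open>t\<close> of the other nodes, so that the position of
    \<open>u\<close> can vary while \<open>t\<close> is fixed.\<close>
  define bad where "bad i u t \<longleftrightarrow> u \<notin> cov (insert_nth i u t)" for i u t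
  define N :: "nat \<Rightarrow> real" where
    "N i = (\<Sum>u\<in>A. \<Sum>t\<in>permutations_of_set (A - {u}). of_bool (bad i u t))" for i
  have n2: "n \<ge> 2" using n by (simp add: n_def)
  have cardP: "card P = fact n" using fin by (simp add: P_def n_def)
  have covA: "cov l \<subseteq> A" for l unfolding cov_def by (rule covered_greedy)
  have l: "set l = A" "distinct l" "length l = n" if "l \<in> P" for l
    using that by (auto simp: P_def permutations_of_set_def n_def distinct_card[symmetric])
  have bad_iff: "bad i u t \<longleftrightarrow> (\<forall>v\<in>A. {u, v} \<in> E \<longrightarrow>
      (\<exists>w\<in>set (take i t). {v, w} \<in> greedy E (A - {u}) (lex_pairs t)))"
    if "u \<in> A" "t \<in> permutations_of_set (A - {u})" for i u t
  proof -
    have t: "set t = A - {u}" "distinct t" using that(2) by (auto simp: permutations_of_set_def)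
    have "distinct (take i t @ u # drop i t)"
      using t set_take_disj_set_drop_if_distinct[of t i i] by (auto dest: in_set_takeD in_set_dropD)
    then have "bad i u t \<longleftrightarrow> (\<forall>v\<in>A \<inter> set t. {u, v} \<in> E \<longrightarrow>
      (\<exists>w\<in>set (take i t). {v, w} \<in> greedy E (A - {u}) (lex_pairs t)))"
      using uncovered_insert_iff[of u A "take i t" "drop i t"] that(1)
      unfolding bad_def cov_def insert_nth_def by simp
    also have "\<dots> \<longleftrightarrow> (\<forall>v\<in>A. {u, v} \<in> E \<longrightarrow>
      (\<exists>w\<in>set (take i t). {v, w} \<in> greedy E (A - {u}) (lex_pairs t)))"
      using t(1) edge_neq by blast
    finally show ?thesis .
  qed
  have bad_mono: "bad j u t" if "u \<in> A" "t \<in> permutations_of_set (A - {u})" "bad i u t" "i \<le> j" for i j u t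
    using that(3) set_take_subset_set_take[OF that(4), of t] unfolding bad_iff[OF that(1,2)] by blast
  have nth: "insert_nth i (l ! i) (removeAll (l ! i) l) = l" "l ! i \<in> A"
    "removeAll (l ! i) l \<in> permutations_of_set (A - {l ! i})"
    "take i (removeAll (l ! i) l) = take i l"
    if "l \<in> P" "i < n" for l i
    using permutations_of_set_nth_split[of l A i] that l(3)[OF that(1)] by (auto simp: P_def n_def)
  have bad_nth: "bad i (l ! i) (removeAll (l ! i) l) \<longleftrightarrow> l ! i \<notin> cov l" if "l \<in> P" "i < n" for l i
    unfolding bad_def nth(1)[OF that] by simp
  \<comment> \<open>Moving the node at position \<open>i\<close> to position \<open>j\<close> gives
    the same count for every \<open>i\<close>.\<close>
  have sum_nth: "(\<Sum>l\<in>P. of_bool (bad j (l ! i) (removeAll (l ! i) l))) = N j" if "i < n" for i j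
    unfolding P_def N_def by (rule sum_permutations_nth[of i A]) (use that in \<open>simp add: n_def\<close>)
  have N_eq: "N i = (\<Sum>l\<in>P. of_bool (l ! i \<notin> cov l))" if "i < n" for i
    unfolding sum_nth[OF that, symmetric] using that bad_nth by (intro sum.cong) auto
  have N_compl: "(\<Sum>l\<in>P. of_bool (l ! i \<in> cov l)) = fact n - N i" if "i < n" for i
  proof -
    have "(\<Sum>l\<in>P. of_bool (l ! i \<in> cov l)) = (\<Sum>l\<in>P. 1 - of_bool (l ! i \<notin> cov l) :: real)"
      by (intro sum.cong) auto
    then show ?thesis using N_eq[OF that] cardP by (simp add: sum_subtractf)
  qed
  have card_nth: "real (card {u \<in> A. Q u}) = (\<Sum>i<n. of_bool (Q (l ! i)))" if "l \<in> P" for Q l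
  proof -
    have "bij_betw ((!) l) {..<n} A" using bij_betw_nth l[OF that] by metis
    then have "(\<Sum>i<n. of_bool (Q (l ! i))) = (\<Sum>u\<in>A. of_bool (Q u) :: real)"
      by (rule sum.reindex_bij_betw)
    then show ?thesis using fin by (simp add: Int_def)
  qed
  have total: "total_covered E A = n * fact n - (\<Sum>i<n. N i)"
  proof -
    have "total_covered E A = (\<Sum>l\<in>P. \<Sum>i<n. of_bool (l ! i \<in> cov l))"
      unfolding total_covered_def P_def[symmetric] cov_def[symmetric]
    proof (intro sum.cong refl)
      fix l assume "l \<in> P"
      have "cov l = {u \<in> A. u \<in> cov l}" using covA by auto
      then show "real (card (cov l)) = (\<Sum>i<n. of_bool (l ! i \<in> cov l))"
        using card_nth[OF \<open>l \<in> P\<close>, of "\<lambda>u. u \<in> cov l"] by simp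
    qed
    also have "\<dots> = (\<Sum>i<n. \<Sum>l\<in>P. of_bool (l ! i \<in> cov l))" by (rule sum.swap)
    also have "\<dots> = (\<Sum>i<n. fact n - N i)" using N_compl by (intro sum.cong) auto
    finally show ?thesis by (simp add: sum_subtractf)
  qed
  \<comment> \<open>Summed over all permutations, the counts of \<open>u = l ! i\<close> that are unmatched at position
    \<open>min i s\<close> yield both \<open>N i\<close> for \<open>i < s\<close> and \<open>n - s\<close> copies of \<open>N s\<close>.\<close>
  have evolve: "real (n - s) * N s + 2 * (\<Sum>i<s. N i) \<le> s * fact n" if s: "s < n" for s
  proof -
    have pointwise: "(\<Sum>i<n. of_bool (bad (min i s) (l ! i) (removeAll (l ! i) l))) \<le>
        (\<Sum>k<s. of_bool (l ! k \<in> cov l) :: real)" if lP: "l \<in> P" for l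
    proof -
      define I where "I = {i. i < n \<and> bad (min i s) (l ! i) (removeAll (l ! i) l)}"
      \<comment> \<open>A node free at position \<open>min i s\<close> is free at its own position
        \<open>i\<close> too, so the run on \<open>l\<close> is the run without it. There its mate
        is matched to one of the first \<open>s\<close> nodes, which is charged; distinct mates make
        the charges distinct.\<close>
      have "\<exists>k<s. {m (l ! i), l ! k} \<in> greedy E A (lex_pairs l)" if "i \<in> I" for i
      proof -
        have i: "i < n" and b: "bad (min i s) (l ! i) (removeAll (l ! i) l)" using that by (auto simp: I_def)
        define u where "u = l ! i"
        define t where "t = removeAll u l"
        have ut: "u \<in> A" "t \<in> permutations_of_set (A - {u})" "take i t = take i l"
          using nth[OF lP i] by (auto simp: u_def t_def)
        have "u \<notin> cov l" using bad_nth[OF lP i] bad_mono[OF ut(1,2), of "min i s" i] b by (simp add: u_def t_def)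
        then have eq: "greedy E (A - {u}) (lex_pairs t) = greedy E A (lex_pairs l)"
          unfolding t_def greedy_lex_pairs_removeAll cov_def by (rule greedy_remove_uncovered)
        obtain w where w: "w \<in> set (take (min i s) t)" "{m u, w} \<in> greedy E A (lex_pairs l)"
          using b m[OF ut(1)] unfolding u_def[symmetric] t_def[symmetric] bad_iff[OF ut(1,2)] eq by blast
        have "take (min i s) t = take s (take i t)" by (simp add: min.commute)
        then have "w \<in> set (take s l)"
          using w(1) ut(3) by (metis in_set_takeD take_take min.commute)
        then obtain k where "k < s" "w = l ! k" by (auto simp: in_set_conv_nth)
        then show ?thesis using w(2) by (auto simp: u_def)
      qed
      then obtain k where k: "\<And>i. i \<in> I \<Longrightarrow> k i < s \<and> {m (l ! i), l ! k i} \<in> greedy E A (lex_pairs l)"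
        by metis
      have "inj_on k I"
      proof (rule inj_onI)
        fix i j assume ij: "i \<in> I" "j \<in> I" "k i = k j"
        then have "{l ! k i, m (l ! i)} \<in> greedy E A (lex_pairs l)" "{l ! k i, m (l ! j)} \<in> greedy E A (lex_pairs l)"
          using k[of i] k[of j] by (simp_all add: insert_commute)
        then have "m (l ! i) = m (l ! j)" by (rule greedy_partner_unique)
        moreover have "i < n" "j < n" using ij by (auto simp: I_def)
        moreover from this have "l ! i \<in> A" "l ! j \<in> A" using l[OF lP] by auto
        ultimately have "l ! i = l ! j" using m by metis
        then show "i = j" using l[OF lP] \<open>i < n\<close> \<open>j < n\<close> by (simp add: nth_eq_iff_index_eq)
      qed
      moreover have "k ` I \<subseteq> {j. j < s \<and> l ! j \<in> cov l}"
        using k by (auto simp: cov_def intro: coveredI)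
      ultimately have "card I \<le> card {j. j < s \<and> l ! j \<in> cov l}"
        by (intro card_inj_on_le[of k]) auto
      moreover have "{..<n} \<inter> {i. bad (min i s) (l ! i) (removeAll (l ! i) l)} = I" by (auto simp: I_def)
      moreover have "{..<s} \<inter> {j. l ! j \<in> cov l} = {j. j < s \<and> l ! j \<in> cov l}" by auto
      ultimately show ?thesis by simp
    qed
    have "(\<Sum>i<n. N (min i s)) = (\<Sum>i<n. \<Sum>l\<in>P. of_bool (bad (min i s) (l ! i) (removeAll (l ! i) l)))"
      using sum_nth by (intro sum.cong) auto
    also have "\<dots> = (\<Sum>l\<in>P. \<Sum>i<n. of_bool (bad (min i s) (l ! i) (removeAll (l ! i) l)))"
      by (rule sum.swap)
    also have "\<dots> \<le> (\<Sum>l\<in>P. \<Sum>k<s. of_bool (l ! k \<in> cov l))"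
      by (rule sum_mono) (rule pointwise)
    also have "\<dots> = (\<Sum>k<s. \<Sum>l\<in>P. of_bool (l ! k \<in> cov l))" by (rule sum.swap)
    also have "\<dots> = (\<Sum>k<s. fact n - N k)" using N_compl s by (intro sum.cong) auto
    also have "\<dots> = s * fact n - (\<Sum>k<s. N k)" by (simp add: sum_subtractf)
    finally have 1: "(\<Sum>i<n. N (min i s)) \<le> s * fact n - (\<Sum>k<s. N k)" .
    have "(\<Sum>i<n. N (min i s)) = (\<Sum>i=0..<s. N (min i s)) + (\<Sum>i=s..<n. N (min i s))"
      unfolding lessThan_atLeast0 by (rule sum.atLeastLessThan_concat[symmetric]) (use s in auto)
    also have "(\<Sum>i=0..<s. N (min i s)) = (\<Sum>i<s. N i)"
      unfolding lessThan_atLeast0 by (intro sum.cong) auto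
    also have "(\<Sum>i=s..<n. N (min i s)) = (\<Sum>i=s..<n. N s)"
      by (intro sum.cong) (auto simp: min_def)
    finally show ?thesis using 1 by simp
  qed
  have boundary: "2 * (n * N (n - 1)) \<le> 3 * total_covered E A"
  proof -
    have pointwise: "2 * (\<Sum>i<n. of_bool (bad (n - 1) (l ! i) (removeAll (l ! i) l))) \<le> 3 * real (card (cov l))"
      if lP: "l \<in> P" for l
    proof -
      \<comment> \<open>\<open>removeAll u l\<close> has \<open>n - 1\<close> entries for
        \<open>u \<in> A\<close>, so insertion at \<open>n - 1\<close> puts \<open>u\<close> at the
        end.\<close>
      define R where "R = {u \<in> A. bad (n - 1) u (removeAll u l)}"
      have "2 * card R \<le> 3 * card (covered (greedy E A (lex_pairs l)))"
      proof (rule boundary_count[OF fin _ m])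
        show "(x, y) \<in> set (lex_pairs l) \<or> (y, x) \<in> set (lex_pairs l)"
          if "x \<in> A" "y \<in> A" "x \<noteq> y" for x y
          using lex_pairs_total that l(1)[OF lP] by metis
        show "R \<subseteq> A" by (auto simp: R_def)
        show "v \<in> covered (greedy E (A - {u}) (lex_pairs l))"
          if u: "u \<in> R" and v: "v \<in> A" "{u, v} \<in> E" for u v
        proof -
          have uA: "u \<in> A" and b: "bad (n - 1) u (removeAll u l)" using u by (auto simp: R_def)
          have "removeAll u l \<in> permutations_of_set (A - {u})"
            using l[OF lP] by (auto simp: permutations_of_set_def distinct_removeAll)
          from b[unfolded bad_iff[OF uA this]] v obtain w where
            "{v, w} \<in> greedy E (A - {u}) (lex_pairs (removeAll u l))" by blast
          then show ?thesis unfolding greedy_lex_pairs_removeAll by (rule coveredI)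
        qed
      qed
      then have "2 * real (card R) \<le> 3 * real (card (cov l))" unfolding cov_def by linarith
      then show ?thesis using card_nth[OF lP, of "\<lambda>u. bad (n - 1) u (removeAll u l)"] by (simp add: R_def)
    qed
    have "2 * (n * N (n - 1)) = 2 * (\<Sum>i<n. \<Sum>l\<in>P. of_bool (bad (n - 1) (l ! i) (removeAll (l ! i) l)))"
      by (simp add: sum_nth)
    also have "\<dots> = (\<Sum>l\<in>P. 2 * (\<Sum>i<n. of_bool (bad (n - 1) (l ! i) (removeAll (l ! i) l))))"
      unfolding sum_distrib_left[symmetric] by (subst sum.swap) simp
    also have "\<dots> \<le> (\<Sum>l\<in>P. 3 * real (card (cov l)))" by (rule sum_mono) (rule pointwise)
    finally show ?thesis by (simp add: total_covered_def cov_def P_def sum_distrib_left)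
  qed
  define y where "y i = N i / fact n" for i
  have sum_y: "(\<Sum>i<s. y i) = (\<Sum>i<s. N i) / fact n" for s
    by (simp add: y_def sum_divide_distrib)
  have "2 * (5 - sqrt 7) / 9 * n \<le> real n - (\<Sum>i<n. y i)"
  proof (rule lp_bound[OF n2])
    show "0 \<le> y s" for s by (simp add: y_def N_def sum_nonneg)
    have "N (n - 1) = (\<Sum>l\<in>P. of_bool (l ! (n - 1) \<notin> cov l))" using n2 by (intro N_eq) simp
    also have "\<dots> \<le> (\<Sum>l\<in>P. 1)" by (rule sum_mono) simp
    finally show "y (n - 1) \<le> 1" by (simp add: y_def cardP)
    show "y s \<le> y (n - 1)" if "s < n" for s
    proof -
      have "N s \<le> N (n - 1)"
        unfolding N_def using that bad_mono[of _ _ s "n - 1"] by (intro sum_mono) auto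
      then show ?thesis by (simp add: y_def divide_right_mono)
    qed
    show "real (n - s) * y s + 2 * (\<Sum>i<s. y i) \<le> s" if "s < n" for s
      using evolve[OF that] by (simp add: y_def sum_y[unfolded y_def] field_simps)
    show "2 * (real n * y (n - 1)) \<le> 3 * (real n - (\<Sum>i<n. y i))"
      using boundary unfolding total by (simp add: y_def sum_y[unfolded y_def] field_simps)
  qed
  also have "\<dots> = total_covered E A / fact n" by (simp add: total sum_y diff_divide_distrib)
  finally show ?thesis by (simp add: n_def)
qed

end

section \<open>Rankings and the main bound\<close>

lemma lex_pairs_sorted:
  assumes "sorted_wrt (\<lambda>x y. \<sigma> x < \<sigma> y) l"
  shows "set (lex_pairs l) = {(u, v). u \<in> set l \<and> v \<in> set l \<and> \<sigma> u < \<sigma> v} \<and>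
    sorted_wrt (precedes \<sigma>) (lex_pairs l)"
  using assms
proof (induction l)
  case (Cons x xs)
  then show ?case
    by (fastforce simp: sorted_wrt_append sorted_wrt_map precedes_def)
qed simp

lemma probe_list_eq_lex_pairs:
  assumes "finite V" "\<sigma> \<in> rankings V" "set l = V" "sorted_wrt (\<lambda>x y. \<sigma> x < \<sigma> y) l"
  shows "probe_list V \<sigma> = lex_pairs l"
  unfolding probe_list_def
  by (rule the1_equality[OF probe_list_ex1[OF assms(1,2)]])
    (use lex_pairs_sorted[OF assms(4)] assms(3) in \<open>auto simp: node_pairs_def\<close>)

lemma expected_matched_eq:
  assumes "finite V"
  shows "expected_matched V E = total_covered E V / fact (card V)"
proof -
  define n where "n = card V"
  \<comment> \<open>Ranks start at 1 and list positions at 0, hence the \<open>Suc\<close> in both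
    of these mutually inverse maps.\<close>
  define list_of where "list_of \<sigma> = map (inv_into V \<sigma>) [1..<Suc n]" for \<sigma> :: "'a \<Rightarrow> nat"
  define rank_of where "rank_of l = restrict (\<lambda>u. Suc (inv_into {..<n} ((!) l) u)) V" for l :: "'a list"
  have list_of: "list_of \<sigma> \<in> permutations_of_set V" "rank_of (list_of \<sigma>) = \<sigma>"
    "ranking_matching V E \<sigma> = greedy E V (lex_pairs (list_of \<sigma>))"
    if \<sigma>: "\<sigma> \<in> rankings V" for \<sigma>
  proof -
    have ext: "\<sigma> \<in> extensional V" and bij: "bij_betw \<sigma> V {1..n}"
      using \<sigma> by (auto simp: rankings_def n_def)
    have bij': "bij_betw (inv_into V \<sigma>) {1..n} V" using bij by (rule bij_betw_inv_into)
    have set_l: "set (list_of \<sigma>) = V"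
      using bij' by (simp add: list_of_def bij_betw_def atLeastLessThanSuc_atLeastAtMost del: upt_Suc)
    moreover have "distinct (list_of \<sigma>)"
      using bij' by (simp add: list_of_def distinct_map bij_betw_def atLeastLessThanSuc_atLeastAtMost del: upt_Suc)
    ultimately show perm: "list_of \<sigma> \<in> permutations_of_set V" by (simp add: permutations_of_set_def)
    have len: "length (list_of \<sigma>) = n" by (simp add: list_of_def)
    have nth: "list_of \<sigma> ! i = inv_into V \<sigma> (Suc i)" if "i < n" for i
      using that by (simp add: list_of_def del: upt_Suc)
    have rank_nth: "\<sigma> (list_of \<sigma> ! i) = Suc i" if "i < n" for i
      unfolding nth[OF that] using bij that by (intro f_inv_into_f) (auto simp: bij_betw_def)
    have inj: "inj_on ((!) (list_of \<sigma>)) {..<n}"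
      using \<open>distinct (list_of \<sigma>)\<close> len by (simp add: inj_on_nth)
    show "rank_of (list_of \<sigma>) = \<sigma>"
    proof
      fix u
      show "rank_of (list_of \<sigma>) u = \<sigma> u"
      proof (cases "u \<in> V")
        case True
        then obtain i where i: "i < n" "u = list_of \<sigma> ! i" using set_l len by (metis in_set_conv_nth)
        then have "inv_into {..<n} ((!) (list_of \<sigma>)) u = i" using inj by (simp add: inv_into_f_f)
        then show ?thesis using True rank_nth i by (simp add: rank_of_def)
      next
        case False
        then show ?thesis using ext by (simp add: rank_of_def extensional_def)
      qed
    qed
    have "sorted_wrt (\<lambda>x y. \<sigma> x < \<sigma> y) (list_of \<sigma>)"
      using rank_nth len by (simp add: sorted_wrt_iff_nth_less)
    then have "probe_list V \<sigma> = lex_pairs (list_of \<sigma>)"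
      by (rule probe_list_eq_lex_pairs[OF assms \<sigma> set_l])
    moreover have "set (lex_pairs (list_of \<sigma>)) \<subseteq> V \<times> V"
      using set_lex_pairs_subset[of "list_of \<sigma>"] set_l by simp
    ultimately show "ranking_matching V E \<sigma> = greedy E V (lex_pairs (list_of \<sigma>))"
      unfolding ranking_matching_def using foldl_probe_eq_greedy[of _ V E "{}"] by simp
  qed
  have rank_of: "rank_of l \<in> rankings V" "list_of (rank_of l) = l"
    if l: "l \<in> permutations_of_set V" for l
  proof -
    have l': "set l = V" "distinct l" "length l = n"
      using l by (auto simp: permutations_of_set_def n_def distinct_card[symmetric])
    have bij: "bij_betw ((!) l) {..<n} V" using bij_betw_nth l' by metis
    have "bij_betw (\<lambda>u. Suc (inv_into {..<n} ((!) l) u)) V (Suc ` {..<n})"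
      using bij_betw_trans[OF bij_betw_inv_into[OF bij] inj_on_imp_bij_betw[of Suc]]
      by (simp add: comp_def)
    moreover have "Suc ` {..<n} = {1..n}" by (simp add: image_Suc_lessThan)
    ultimately have bijr: "bij_betw (rank_of l) V {1..n}"
      by (simp add: rank_of_def bij_betw_restrict_eq)
    then show "rank_of l \<in> rankings V" by (simp add: rankings_def rank_of_def n_def)
    have nth: "inv_into V (rank_of l) (Suc i) = l ! i" if "i < n" for i
    proof -
      have "l ! i \<in> V" using l' that by auto
      moreover have "rank_of l (l ! i) = Suc i"
        using that bij calculation by (simp add: rank_of_def bij_betw_def inv_into_f_f)
      ultimately show ?thesis using bijr by (metis bij_betw_inv_into_left)
    qed
    show "list_of (rank_of l) = l"
      using nth l'(3) by (intro nth_equalityI) (auto simp: list_of_def simp del: upt_Suc)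
  qed
  have "(\<Sum>\<sigma>\<in>rankings V. real (card (covered (ranking_matching V E \<sigma>)))) = total_covered E V"
    unfolding total_covered_def
    by (rule sum.reindex_bij_witness[of _ rank_of list_of]) (use list_of rank_of in auto)
  moreover have "card (rankings V) = fact n"
  proof -
    have "bij_betw list_of (rankings V) (permutations_of_set V)"
      by (rule bij_betw_byWitness[of _ rank_of]) (use list_of rank_of in auto)
    then show ?thesis using bij_betw_same_card assms by (metis card_permutations_of_set n_def)
  qed
  ultimately show ?thesis
    using finite_rankings[OF assms] rankings_nonempty[OF assms]
    by (simp add: expected_matched_def integral_pmf_of_set n_def)
qed

theorem theorem1:
  fixes V :: "'a set" and E M :: "'a set set"
  assumes "finite_graph V E" and "E \<noteq> {}"
    and "maximum_matching E M"
  shows "expected_matched V E / real (card (covered M)) \<ge> 2 * (5 - sqrt 7) / 9"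
proof -
  interpret simple_edges E using assms(1) by unfold_locales (simp add: finite_graph_def)
  have fin: "finite V" and EV: "\<And>e. e \<in> E \<Longrightarrow> e \<subseteq> V"
    using assms(1) by (auto simp: finite_graph_def)
  have ME: "M \<subseteq> E" and disj: "disjoint M"
    using assms(3) by (auto simp: maximum_matching_def matching_def)
  define W where "W = covered M"
  have WV: "W \<subseteq> V" using ME EV by (auto simp: W_def covered_def)
  have finW: "finite W" using fin WV by (rule rev_finite_subset)
  obtain e where "e \<in> E" using assms(2) by blast
  \<comment> \<open>A single edge is a matching, so \<open>M\<close> is nonempty; this gives
    \<open>card W \<ge> 2\<close>.\<close>
  then have "matching E {e}" by (simp add: matching_def)
  then have "card {e} \<le> card M" using assms(3) unfolding maximum_matching_def by blast
  then obtain e' where e': "e' \<in> M" by (metis all_not_in_conv card.empty card_insert_if empty_iff finite.emptyI not_one_le_zero One_nat_def)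
  then have "card e' = 2" "e' \<subseteq> W" using ME card_edge by (auto simp: W_def covered_def)
  then have W2: "card W \<ge> 2" using card_mono[OF finW] by metis
  have "\<exists>v. {u, v} \<in> M" if "u \<in> W" for u
    using coveredE[OF ME] that unfolding W_def by metis
  then obtain m where m: "\<And>u. u \<in> W \<Longrightarrow> {u, m u} \<in> M" by metis
  have mW: "m u \<in> W" if "u \<in> W" for u using coveredI(2)[OF m[OF that]] by (simp add: W_def)
  have mm: "m (m u) = u" if "u \<in> W" for u
    using disjoint_partner_unique[OF disj, of "m u" "m (m u)" u] m[OF mW[OF that]] m[OF that] by (simp add: insert_commute)
  have "2 * (5 - sqrt 7) / 9 * card W \<le> total_covered E W / fact (card W)"
    by (rule total_covered_perfect[OF finW W2, of m]) (use m mW mm ME in auto)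
  also have "\<dots> \<le> expected_matched V E"
    unfolding expected_matched_eq[OF fin] by (rule total_covered_subset[OF fin WV])
  finally show ?thesis using W2 unfolding W_def[symmetric] by (simp add: pos_le_divide_eq)
qed

end
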